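(* Let $p,m\ge 1$, $J:=\{1,\ldots,p\}$, $I:=\{1,\ldots,m\}$. For each $k=0,1,2,\ldots$, let $U_k:=\sum_{j=1}^{p}\omega_j^kU_j^k$, where $U_j^k\colon\mathcal H\to\mathcal H$ is $\rho_j^k$-strongly quasi-nonexpansive, $\rho_j^k\ge 0$, $\omega_j^k\ge 0$ for $j\in J$, and $\sum_{j\in J}\omega_j^k=1$. (Upper indices $k$ are indices, not powers.) For each $i\in I$ let $C_i\subseteq\mathcal H$ be closed and convex. Let $S\subseteq\mathcal H$ be nonempty and bounded, let $F_0:=\bigcap_{j\in J}\bigcap_{k\ge 0}\operatorname{Fix}U_j^k$ and $C:=\bigcap_{i\in I}C_i$, and assume that $C\subseteq F_0$ and $C\neq\emptyset$. (i) Suppose that for some $i\in I$ there is a sequence $\{j_k\}_{k=0}^\infty\subseteq J$ such that the sequence $\{U_{j_k}^k\}_{k=0}^\infty$ is weakly $C_i$-regular over $S$ and $\sigma_i:=\inf_k\omega_{j_k}^k\rho_{j_k}^k>0$. Then $\{U_k\}_{k=0}^\infty$ is weakly $C_i$-regular over $S$. If this property holds for all $i\in I$ (with $\{j_k\}$ allowed to depend on $i$), then $\{U_k\}_{k=0}^\infty$ is weakly $C$-regular over $S$. (ii) Suppose that for some $i\in I$ there is a sequence $\{j_k\}_{k=0}^\infty\subseteq J$ such that the sequence $\{U_{j_k}^k\}_{k=0}^\infty$ is $C_i$-regular over $S$ and $\sigma_i:=\inf_k\omega_{j_k}^k\rho_{j_k}^k>0$. Then $\{U_k\}_{k=0}^\infty$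 is $C_i$-regular over $S$. If this property holds for all $i\in I$ (with $\{j_k\}$ allowed to depend on $i$) and the family $\{C_i\mid i\in I\}$ is regular over $S$, then $\{U_k\}_{k=0}^\infty$ is $C$-regular over $S$. (iii) Suppose that for every $i\in I$ there is a sequence $\{j_k\}_{k=0}^\infty\subseteq J$ (depending on $i$) such that the sequence $\{U_{j_k}^k\}_{k=0}^\infty$ is linearly $C_i$-regular over $S$ with modulus $\delta_i$ and $\sigma_i:=\inf_k\omega_{j_k}^k\rho_{j_k}^k>0$, and suppose that $\{C_i\mid i\in I\}$ is linearly regular over $S$ with modulus $\kappa>0$. Then $\{U_k\}_{k=0}^\infty$ is linearly $C$-regular over $S$ with modulus $2\kappa^2\delta^2/\sigma$, where $\sigma:=\min_{i\in I}\sigma_i$ and $\delta:=\min_{i\in I}\delta_i$.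
   Context: $\mathcal H$ is a real Hilbert space, $\operatorname{Fix}U:=\{x\in\mathcal H\mid Ux=x\}$, and $d(x,C):=\inf_{y\in C}\|x-y\|$. For $\rho\ge 0$, an operator $T\colon\mathcal H\to\mathcal H$ is $\rho$-strongly quasi-nonexpansive if $\operatorname{Fix}T\ne\emptyset$ and $\|Tu-z\|^2\le\|u-z\|^2-\rho\|Tu-u\|^2$ for all $u\in\mathcal H$, $z\in\operatorname{Fix}T$; it is quasi-nonexpansive if this holds with $\rho=0$. Regular sequences of operators. Let $S\subseteq\mathcal H$ be nonempty and $D\subseteq\mathcal H$ be nonempty, closed and convex. A sequence $\{V_k\}_{k=0}^\infty$ of quasi-nonexpansive operators $V_k\colon\mathcal H\to\mathcal H$ is: (a) weakly $D$-regular over $S$ if for every sequence $\{x^k\}_{k=0}^\infty\subseteq S$ and every strictly increasing sequence $\{n_k\}$ of nonnegative integers, $x^{n_k}\rightharpoonup y$ (weakly, as $k\to\infty$) and $\|V_kx^k-x^k\|\to 0$ imply $y\in D$; (b) $D$-regular over $S$ if for every sequence $\{x^k\}_{k=0}^\infty\subseteq S$, $\|V_kx^k-x^k\|\to 0$ implies $d(x^k,D)\to 0$; (c) linearly $D$-regular over $S$ with modulus $\delta>0$ if $d(x,D)\le\delta\|V_kx-x\|$ for all $x\in S$ and all $k=0,1,2,\ldots$. Regular families of sets. A family of closed convex sets $C_i$, $i\in I=\{1,\ldots,m\}$, with $C=\bigcap_{i\in I}C_i\neq\emptyset$ is regular over $S$ if for every sequence $\{x^k\}_{k=0}^\infty\subseteq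 S$, $\max_{i\in I}d(x^k,C_i)\to 0$ implies $d(x^k,C)\to 0$; it is linearly regular over $S$ with modulus $\kappa>0$ if $d(x,C)\le\kappa\max_{i\in I}d(x,C_i)$ for all $x\in S$.
   Formalization: In (iii) the formal theorem takes δ to be the maximum of the δ_i instead of the minimum; with the minimum the claim is false (e.g. U x = x/2 on the reals, C_1 = R with δ_1 = 1/10, C_2 = {0} with δ_2 = 2, S = [-1,1], κ = 1). *)

theory Defs
  imports "HOL-Analysis.Analysis"
begin

text \<open>A real Hilbert space is a type of sort \<open>{real_inner, complete_space}\<close>, and the distance
  \<open>d(x, C)\<close> is \<open>infdist x C\<close>, which agrees with the infimum for nonempty \<open>C\<close>.\<close>

definition Fix :: "('a \<Rightarrow> 'a) \<Rightarrow> 'a set" where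
  "Fix T = {x. T x = x}"

definition strongly_quasi_nonexpansive :: "real \<Rightarrow> ('a::real_inner \<Rightarrow> 'a) \<Rightarrow> bool" where
  "strongly_quasi_nonexpansive \<rho> T \<longleftrightarrow>
     Fix T \<noteq> {} \<and>
     (\<forall>u. \<forall>z\<in>Fix T. (norm (T u - z))\<^sup>2 \<le> (norm (u - z))\<^sup>2 - \<rho> * (norm (T u - u))\<^sup>2)"

definition quasi_nonexpansive :: "('a::real_inner \<Rightarrow> 'a) \<Rightarrow> bool" where
  "quasi_nonexpansive T \<longleftrightarrow> strongly_quasi_nonexpansive 0 T"

text \<open>Weak convergence, with continuous functionals represented as inner products.\<close>

definition weakly_converges :: "(nat \<Rightarrow> 'a::real_inner) \<Rightarrow> 'a \<Rightarrow> bool" where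
  "weakly_converges x y \<longleftrightarrow> (\<forall>z. (\<lambda>k. inner (x k) z) \<longlonglongrightarrow> inner y z)"

text \<open>Regular sequences of operators are by definition sequences of quasi-nonexpansive operators.
  The sets \<open>D\<close> and \<open>S\<close> are meant to be nonempty, and \<open>D\<close> closed and convex.\<close>

definition weakly_regular_over ::
    "(nat \<Rightarrow> 'a::real_inner \<Rightarrow> 'a) \<Rightarrow> 'a set \<Rightarrow> 'a set \<Rightarrow> bool" where
  "weakly_regular_over V D S \<longleftrightarrow>
     (\<forall>k. quasi_nonexpansive (V k)) \<and>
     (\<forall>x n y. (\<forall>k. x k \<in> S) \<and> strict_mono n \<and> weakly_converges (\<lambda>k. x (n k)) y \<and>
        (\<lambda>k. norm (V k (x k) - x k)) \<longlonglongrightarrow> 0 \<longrightarrow> y \<in> D)"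

definition regular_over ::
    "(nat \<Rightarrow> 'a::real_inner \<Rightarrow> 'a) \<Rightarrow> 'a set \<Rightarrow> 'a set \<Rightarrow> bool" where
  "regular_over V D S \<longleftrightarrow>
     (\<forall>k. quasi_nonexpansive (V k)) \<and>
     (\<forall>x. (\<forall>k. x k \<in> S) \<and> (\<lambda>k. norm (V k (x k) - x k)) \<longlonglongrightarrow> 0 \<longrightarrow>
        (\<lambda>k. infdist (x k) D) \<longlonglongrightarrow> 0)"

text \<open>The condition weakens as \<open>\<delta>\<close> grows, so a modulus valid for several sequences at once is the
  maximum, not the minimum, of their moduli.\<close>

definition linearly_regular_over ::
    "real \<Rightarrow> (nat \<Rightarrow> 'a::real_inner \<Rightarrow> 'a) \<Rightarrow> 'a set \<Rightarrow> 'a set \<Rightarrow> bool" where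
  "linearly_regular_over \<delta> V D S \<longleftrightarrow>
     (\<forall>k. quasi_nonexpansive (V k)) \<and> \<delta> > 0 \<and>
     (\<forall>x\<in>S. \<forall>k. infdist x D \<le> \<delta> * norm (V k x - x))"

definition regular_family_over ::
    "'i set \<Rightarrow> ('i \<Rightarrow> 'a::real_inner set) \<Rightarrow> 'a set \<Rightarrow> bool" where
  "regular_family_over I C S \<longleftrightarrow>
     (\<forall>x :: nat \<Rightarrow> 'a. (\<forall>k. x k \<in> S) \<and> (\<lambda>k. MAX i\<in>I. infdist (x k) (C i)) \<longlonglongrightarrow> 0 \<longrightarrow>
        (\<lambda>k. infdist (x k) (\<Inter>i\<in>I. C i)) \<longlonglongrightarrow> 0)"

definition linearly_regular_family_over ::
    "real \<Rightarrow> 'i set \<Rightarrow> ('i \<Rightarrow> 'a::real_inner set) \<Rightarrow> 'a set \<Rightarrow> bool" where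
  "linearly_regular_family_over \<kappa> I C S \<longleftrightarrow>
     \<kappa> > 0 \<and> (\<forall>x\<in>S. infdist x (\<Inter>i\<in>I. C i) \<le> \<kappa> * (MAX i\<in>I. infdist x (C i)))"

end

theory Submission
  imports Defs
begin

text \<open>Everything follows from one estimate. Let \<open>z\<close> be a common fixed point of the operators
  \<open>U j k\<close> that carry positive weight in the average \<open>V k\<close>. The variance identity for convex
  combinations and the strong quasi-nonexpansivity of the \<open>U j k\<close> give
  \<open>\<parallel>V x - z\<parallel>\<^sup>2 + \<Sum>\<omega> j \<parallel>U j x - V x\<parallel>\<^sup>2 + \<Sum>\<omega> j \<rho> j \<parallel>U j x - x\<parallel>\<^sup>2 \<le> \<parallel>x - z\<parallel>\<^sup>2\<close> (at a fixed \<open>k\<close>).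

  The first sum shows that a fixed point of \<open>V\<close> is fixed by every \<open>U j\<close> of positive
  weight, even when all the \<open>\<rho> j\<close> vanish; hence \<open>V\<close> is quasi-nonexpansive. The second sum, after
  \<open>\<parallel>x - z\<parallel>\<^sup>2 - \<parallel>V x - z\<parallel>\<^sup>2\<close> is bounded by the triangle inequality, gives
  \<open>\<omega> j \<rho> j \<parallel>U j x - x\<parallel>\<^sup>2 \<le> 2 \<parallel>x - z\<parallel> \<parallel>V x - x\<parallel>\<close> (lemma \<open>residual_bound\<close>).

  On a bounded set \<open>S\<close>, with \<open>\<omega> j \<rho> j\<close> bounded away from zero along the selected indices, small
  residuals of \<open>V\<close> therefore force small residuals of the selected operators. That transfers weak
  regularity and regularity from the selected operators to \<open>V\<close>, first for each \<open>C i\<close> and then for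
  their intersection. For linear regularity the infimum over \<open>z \<in> C\<close> replaces \<open>\<parallel>x - z\<parallel>\<close> by
  \<open>d(x, C)\<close>; so \<open>d(x, C)\<^sup>2 \<le> \<kappa>\<^sup>2 \<delta>\<^sup>2 \<parallel>U j x - x\<parallel>\<^sup>2 \<le> (2 \<kappa>\<^sup>2 \<delta>\<^sup>2 / \<sigma>) d(x, C) \<parallel>V x - x\<parallel>\<close>, and one
  factor \<open>d(x, C)\<close> cancels.\<close>

section \<open>Auxiliary facts on averages and limits\<close>

text \<open>The parallel-axis (variance) identity: expand \<open>\<parallel>(u j - v) + (v - z)\<parallel>\<^sup>2\<close> around the mean
  \<open>v\<close>; the weighted cross terms cancel.\<close>

lemma variance_identity:
  fixes u :: "'i \<Rightarrow> 'a::real_inner"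
  assumes "(\<Sum>j\<in>A. w j) = 1" and v: "v = (\<Sum>j\<in>A. w j *\<^sub>R u j)"
  shows "(norm (v - z))\<^sup>2 + (\<Sum>j\<in>A. w j * (norm (u j - v))\<^sup>2)
       = (\<Sum>j\<in>A. w j * (norm (u j - z))\<^sup>2)"
proof -
  have expand: "(norm (u j - z))\<^sup>2
      = (norm (u j - v))\<^sup>2 + 2 * inner (u j - v) (v - z) + (norm (v - z))\<^sup>2" for j
    by (simp add: power2_norm_eq_inner algebra_simps inner_commute)
  have "(\<Sum>j\<in>A. w j *\<^sub>R (u j - v)) = 0"
    by (simp add: scaleR_diff_right sum_subtractf flip: v scaleR_left.sum)
       (simp add: assms(1))
  then have cross: "(\<Sum>j\<in>A. w j * inner (u j - v) (v - z)) = 0"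
    by (simp flip: inner_scaleR_left inner_sum_left)
  have "(\<Sum>j\<in>A. w j * (norm (u j - z))\<^sup>2)
      = (\<Sum>j\<in>A. w j * (norm (u j - v))\<^sup>2)
        + 2 * (\<Sum>j\<in>A. w j * inner (u j - v) (v - z)) + (\<Sum>j\<in>A. w j) * (norm (v - z))\<^sup>2"
    unfolding expand
    by (simp add: distrib_left sum.distrib sum_distrib_left sum_distrib_right mult.left_commute)
  then show ?thesis
    using cross assms(1) by simp
qed

lemma tendsto_zero_of_square_bound:
  fixes f g :: "nat \<Rightarrow> real"
  assumes bound: "\<And>k. \<sigma> * (f k)\<^sup>2 \<le> M * g k" and "\<sigma> > 0" and g: "g \<longlonglongrightarrow> 0"
  shows "f \<longlonglongrightarrow> 0"
proof -
  have le: "(f k)\<^sup>2 \<le> M / \<sigma> * g k" for k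
    using bound[of k] \<open>\<sigma> > 0\<close> by (simp add: field_simps)
  have "(\<lambda>k. M / \<sigma> * g k) \<longlonglongrightarrow> 0"
    by (rule tendsto_mult_right_zero[OF g])
  then have "(\<lambda>k. (f k)\<^sup>2) \<longlonglongrightarrow> 0"
    by (rule tendsto_sandwich[rotated 2, OF tendsto_const])
       (use le in \<open>auto intro!: always_eventually simp del: times_divide_eq_left\<close>)
  then have "(\<lambda>k. \<bar>f k\<bar>) \<longlonglongrightarrow> 0"
    using tendsto_real_sqrt by fastforce
  then show ?thesis
    by (rule tendsto_rabs_zero_cancel)
qed

lemma Max_tendsto_zero:
  fixes f :: "nat \<Rightarrow> 'i \<Rightarrow> real"
  assumes "finite I" "I \<noteq> {}"
    and nonneg: "\<And>k i. i \<in> I \<Longrightarrow> 0 \<le> f k i"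
    and lim: "\<And>i. i \<in> I \<Longrightarrow> (\<lambda>k. f k i) \<longlonglongrightarrow> 0"
  shows "(\<lambda>k. MAX i\<in>I. f k i) \<longlonglongrightarrow> 0"
proof (rule tendsto_sandwich[where f = "\<lambda>_. 0" and h = "\<lambda>k. \<Sum>i\<in>I. f k i"])
  show "(\<lambda>k. \<Sum>i\<in>I. f k i) \<longlonglongrightarrow> 0"
    using lim by (rule tendsto_null_sum)
  show "\<forall>\<^sub>F k in sequentially. (MAX i\<in>I. f k i) \<le> (\<Sum>i\<in>I. f k i)"
    using assms(1,2) nonneg by (auto intro!: always_eventually member_le_sum)
  show "\<forall>\<^sub>F k in sequentially. 0 \<le> (MAX i\<in>I. f k i)"
    using assms(1,2) nonneg by (auto intro!: always_eventually simp: Max_ge_iff)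
qed simp

text \<open>A bound valid at every point of \<open>Z\<close> passes to the infimum, so a nearest point of \<open>Z\<close> never
  has to be chosen.\<close>

lemma infdist_mult_ge:
  fixes x :: "'a::real_normed_vector"
  assumes "Z \<noteq> {}" and "0 \<le> c" and bound: "\<And>z. z \<in> Z \<Longrightarrow> b \<le> norm (x - z) * c"
  shows "b \<le> infdist x Z * c"
proof (cases "c = 0")
  case True
  then show ?thesis
    using assms(1) bound by force
next
  case False
  then have "b / c \<le> infdist x Z"
    using assms unfolding infdist_notempty[OF assms(1)]
    by (intro cINF_greatest) (auto simp: dist_norm field_simps)
  then show ?thesis
    using False \<open>0 \<le> c\<close> by (simp add: field_simps)
qed

section \<open>Averages of strongly quasi-nonexpansive operators\<close>

text \<open>The set \<open>Z\<close> of common fixed points is a parameter so that bounds in terms of \<open>infdist x Z\<close>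
  can be applied to the intersection of the target sets, which may be smaller than the set of all
  common fixed points.\<close>

locale averaged_operators =
  fixes A :: "'i set"
    and \<omega> \<rho> :: "'i \<Rightarrow> nat \<Rightarrow> real"
    and U :: "'i \<Rightarrow> nat \<Rightarrow> 'a::real_inner \<Rightarrow> 'a"
    and V :: "nat \<Rightarrow> 'a \<Rightarrow> 'a"
    and Z :: "'a set"
  assumes finite_A: "finite A"
    and \<rho>_nonneg: "j \<in> A \<Longrightarrow> 0 \<le> \<rho> j k"
    and sqne: "j \<in> A \<Longrightarrow> strongly_quasi_nonexpansive (\<rho> j k) (U j k)"
    and \<omega>_nonneg: "j \<in> A \<Longrightarrow> 0 \<le> \<omega> j k"
    and \<omega>_sum: "(\<Sum>j\<in>A. \<omega> j k) = 1"
    and V_eq: "V k x = (\<Sum>j\<in>A. \<omega> j k *\<^sub>R U j k x)"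
    and Z_fixed: "j \<in> A \<Longrightarrow> Z \<subseteq> Fix (U j k)"
    and Z_nonempty: "Z \<noteq> {}"
begin

text \<open>Quasi-nonexpansivity of \<open>V k\<close> concerns every fixed point of \<open>V k\<close>, and such a point may be
  moved by operators of weight zero. Hence \<open>z\<close> ranges over the points fixed by the operators of
  nonzero weight and not just over \<open>Z\<close>.\<close>

lemma average_estimate:
  assumes z: "\<And>j. j \<in> A \<Longrightarrow> \<omega> j k \<noteq> 0 \<Longrightarrow> z \<in> Fix (U j k)"
  shows "(norm (V k x - z))\<^sup>2 + (\<Sum>j\<in>A. \<omega> j k * (norm (U j k x - V k x))\<^sup>2)
       + (\<Sum>j\<in>A. \<omega> j k * \<rho> j k * (norm (U j k x - x))\<^sup>2) \<le> (norm (x - z))\<^sup>2"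
proof -
  have "(\<Sum>j\<in>A. \<omega> j k * (norm (U j k x - z))\<^sup>2)
      \<le> (\<Sum>j\<in>A. \<omega> j k * ((norm (x - z))\<^sup>2 - \<rho> j k * (norm (U j k x - x))\<^sup>2))"
  proof (rule sum_mono)
    fix j assume j: "j \<in> A"
    show "\<omega> j k * (norm (U j k x - z))\<^sup>2
        \<le> \<omega> j k * ((norm (x - z))\<^sup>2 - \<rho> j k * (norm (U j k x - x))\<^sup>2)"
    proof (cases "\<omega> j k = 0")
      case False
      then show ?thesis
        using sqne[OF j, of k] z[OF j] \<omega>_nonneg[OF j, of k]
        by (intro mult_left_mono) (auto simp: strongly_quasi_nonexpansive_def)
    qed simp
  qed
  also have "\<dots> = (\<Sum>j\<in>A. \<omega> j k) * (norm (x - z))\<^sup>2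
      - (\<Sum>j\<in>A. \<omega> j k * \<rho> j k * (norm (U j k x - x))\<^sup>2)"
    by (simp add: right_diff_distrib sum_subtractf sum_distrib_right mult.assoc)
  finally show ?thesis
    using variance_identity[OF \<omega>_sum V_eq, of k x z] by (simp add: \<omega>_sum)
qed

lemma variance_nonneg: "0 \<le> (\<Sum>j\<in>A. \<omega> j k * (norm (U j k x - V k x))\<^sup>2)"
  by (intro sum_nonneg mult_nonneg_nonneg) (auto simp: \<omega>_nonneg)

lemma weighted_residuals_nonneg:
  "0 \<le> (\<Sum>j\<in>A. \<omega> j k * \<rho> j k * (norm (U j k x - x))\<^sup>2)"
  by (intro sum_nonneg mult_nonneg_nonneg) (auto simp: \<omega>_nonneg \<rho>_nonneg)

lemma Z_subset_Fix: "Z \<subseteq> Fix (V k)"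
proof
  fix z assume "z \<in> Z"
  then have "V k z = (\<Sum>j\<in>A. \<omega> j k *\<^sub>R z)"
    unfolding V_eq using Z_fixed by (intro sum.cong) (auto simp: Fix_def)
  then show "z \<in> Fix (V k)"
    by (simp add: Fix_def \<omega>_sum flip: scaleR_left.sum)
qed

text \<open>At a fixed point of \<open>V k\<close> the estimate against any point of \<open>Z\<close> forces the variance of the
  values \<open>U j k x\<close> to vanish, so they all coincide with their mean, the point itself.\<close>

lemma fixed_point_of_average:
  assumes x: "x \<in> Fix (V k)" and j: "j \<in> A" "\<omega> j k \<noteq> 0"
  shows "x \<in> Fix (U j k)"
proof -
  obtain z where z: "z \<in> Z"
    using Z_nonempty by blast
  have Vx: "V k x = x"
    using x by (simp add: Fix_def)
  have "(\<Sum>j\<in>A. \<omega> j k * (norm (U j k x - V k x))\<^sup>2) \<le> 0"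
    using average_estimate[of k z x] Z_fixed z weighted_residuals_nonneg[of k x]
    by (simp add: Vx subset_iff)
  then have "(\<Sum>j\<in>A. \<omega> j k * (norm (U j k x - V k x))\<^sup>2) = 0"
    using variance_nonneg[of k x] by linarith
  then have "\<omega> j k * (norm (U j k x - V k x))\<^sup>2 = 0"
    using finite_A \<omega>_nonneg j(1) by (subst (asm) sum_nonneg_eq_0_iff) auto
  then show ?thesis
    using j(2) by (simp add: Vx Fix_def)
qed

lemma quasi_nonexpansive_average: "quasi_nonexpansive (V k)"
  unfolding quasi_nonexpansive_def strongly_quasi_nonexpansive_def
proof (intro conjI allI ballI)
  show "Fix (V k) \<noteq> {}"
    using Z_nonempty Z_subset_Fix by blast
  fix u z assume "z \<in> Fix (V k)"
  then have "(norm (V k u - z))\<^sup>2 + (\<Sum>j\<in>A. \<omega> j k * (norm (U j k u - V k u))\<^sup>2)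
       + (\<Sum>j\<in>A. \<omega> j k * \<rho> j k * (norm (U j k u - u))\<^sup>2) \<le> (norm (u - z))\<^sup>2"
    by (intro average_estimate fixed_point_of_average)
  then show "(norm (V k u - z))\<^sup>2 \<le> (norm (u - z))\<^sup>2 - 0 * (norm (V k u - u))\<^sup>2"
    using variance_nonneg[of k u] weighted_residuals_nonneg[of k u] by linarith
qed

text \<open>Writing \<open>a = \<parallel>x - z\<parallel>\<close> and \<open>b = \<parallel>V k x - z\<parallel>\<close>, the estimate bounds the left-hand side by
  \<open>(a - b) (a + b)\<close>; here \<open>b \<le> a\<close>, and \<open>a - b \<le> \<parallel>V k x - x\<parallel>\<close> by the triangle inequality.\<close>

lemma residual_bound:
  assumes j: "j \<in> A" and z: "z \<in> Z"
  shows "\<omega> j k * \<rho> j k * (norm (U j k x - x))\<^sup>2 \<le> 2 * norm (x - z) * norm (V k x - x)"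
proof -
  let ?a = "norm (x - z)" and ?b = "norm (V k x - z)" and ?r = "norm (V k x - x)"
  let ?s = "\<Sum>j\<in>A. \<omega> j k * \<rho> j k * (norm (U j k x - x))\<^sup>2"
  have sum_le: "?s \<le> ?a\<^sup>2 - ?b\<^sup>2"
    using average_estimate[of k z x] Z_fixed z variance_nonneg[of k x] by (simp add: subset_iff)
  then have "?b\<^sup>2 \<le> ?a\<^sup>2"
    using weighted_residuals_nonneg[of k x] by linarith
  then have "?b \<le> ?a"
    by simp
  moreover have "?a - ?b \<le> ?r"
    using norm_triangle_ineq2[of "x - z" "V k x - z"] by (simp add: norm_minus_commute)
  ultimately have "(?a - ?b) * (?a + ?b) \<le> ?r * (2 * ?a)"
    by (intro mult_mono) auto
  then have "?a\<^sup>2 - ?b\<^sup>2 \<le> 2 * ?a * ?r"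
    by (simp add: power2_eq_square algebra_simps)
  moreover have "\<omega> j k * \<rho> j k * (norm (U j k x - x))\<^sup>2 \<le> ?s"
    using finite_A j \<omega>_nonneg \<rho>_nonneg by (intro member_le_sum) auto
  ultimately show ?thesis
    using sum_le by linarith
qed

lemma residual_bound_infdist:
  assumes "j \<in> A"
  shows "\<omega> j k * \<rho> j k * (norm (U j k x - x))\<^sup>2 \<le> 2 * infdist x Z * norm (V k x - x)"
  using infdist_mult_ge[of Z "2 * norm (V k x - x)" _ x] residual_bound[OF assms] Z_nonempty
  by (simp add: algebra_simps)

lemma selected_weight_ge_INF:
  assumes "\<And>k. J k \<in> A"
  shows "(INF k. \<omega> (J k) k * \<rho> (J k) k) \<le> \<omega> (J k) k * \<rho> (J k) k"
  using assms \<omega>_nonneg \<rho>_nonneg by (intro cINF_lower bdd_belowI2[where m = 0]) auto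

section \<open>Transfer of regularity to the average\<close>

text \<open>Boundedness of \<open>S\<close> enters through the factor \<open>\<parallel>x - z\<parallel>\<close> in the residual bound.\<close>

lemma selected_residuals_tendsto_zero:
  assumes J: "\<And>k. J k \<in> A" and pos: "(INF k. \<omega> (J k) k * \<rho> (J k) k) > 0"
    and "bounded S" and x: "\<And>k. x k \<in> S"
    and lim: "(\<lambda>k. norm (V k (x k) - x k)) \<longlonglongrightarrow> 0"
  shows "(\<lambda>k. norm (U (J k) k (x k) - x k)) \<longlonglongrightarrow> 0"
proof -
  obtain z where z: "z \<in> Z"
    using Z_nonempty by blast
  obtain B where B: "\<And>y. y \<in> S \<Longrightarrow> norm (y - z) \<le> B"
    using \<open>bounded S\<close> unfolding bounded_any_center[where a = z]
    by (metis dist_commute dist_norm)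
  let ?\<sigma> = "INF k. \<omega> (J k) k * \<rho> (J k) k"
  have "?\<sigma> * (norm (U (J k) k (x k) - x k))\<^sup>2 \<le> 2 * B * norm (V k (x k) - x k)" for k
  proof -
    have "?\<sigma> * (norm (U (J k) k (x k) - x k))\<^sup>2
        \<le> \<omega> (J k) k * \<rho> (J k) k * (norm (U (J k) k (x k) - x k))\<^sup>2"
      using selected_weight_ge_INF[where J = J, OF J] by (intro mult_right_mono) auto
    also have "\<dots> \<le> 2 * norm (x k - z) * norm (V k (x k) - x k)"
      using J z by (rule residual_bound)
    also have "\<dots> \<le> 2 * B * norm (V k (x k) - x k)"
      using B[OF x] by (intro mult_right_mono) auto
    finally show ?thesis .
  qed
  then show ?thesis
    using pos lim by (rule tendsto_zero_of_square_bound)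
qed

lemma weakly_regular_average:
  assumes "\<And>k. J k \<in> A" and "(INF k. \<omega> (J k) k * \<rho> (J k) k) > 0" and "bounded S"
    and "weakly_regular_over (\<lambda>k. U (J k) k) D S"
  shows "weakly_regular_over V D S"
  unfolding weakly_regular_over_def
proof (intro conjI allI impI; (elim conjE)?)
  fix x n y
  assume x: "\<forall>k. x k \<in> S" and "(\<lambda>k. norm (V k (x k) - x k)) \<longlonglongrightarrow> 0"
    and sub: "strict_mono n" "weakly_converges (\<lambda>k. x (n k)) y"
  then have "(\<lambda>k. norm (U (J k) k (x k) - x k)) \<longlonglongrightarrow> 0"
    using assms(1-3) by (intro selected_residuals_tendsto_zero) auto
  then show "y \<in> D"
    using assms(4) x sub unfolding weakly_regular_over_def by blast
qed (rule quasi_nonexpansive_average)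

lemma regular_average:
  assumes "\<And>k. J k \<in> A" and "(INF k. \<omega> (J k) k * \<rho> (J k) k) > 0" and "bounded S"
    and "regular_over (\<lambda>k. U (J k) k) D S"
  shows "regular_over V D S"
  unfolding regular_over_def
proof (intro conjI allI impI; (elim conjE)?)
  fix x
  assume x: "\<forall>k. x k \<in> S" and "(\<lambda>k. norm (V k (x k) - x k)) \<longlonglongrightarrow> 0"
  then have "(\<lambda>k. norm (U (J k) k (x k) - x k)) \<longlonglongrightarrow> 0"
    using assms(1-3) by (intro selected_residuals_tendsto_zero) auto
  then show "(\<lambda>k. infdist (x k) D) \<longlonglongrightarrow> 0"
    using assms(4) x unfolding regular_over_def by blast
qed (rule quasi_nonexpansive_average)

text \<open>The residual bound controls the square of the selected residual, so the linear estimate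
  \<open>d(x, Z) \<le> \<kappa> \<delta> \<parallel>U j k x - x\<parallel>\<close> is squared first; this makes the modulus quadratic in \<open>\<kappa>\<close> and
  \<open>\<delta>\<close>. The factor \<open>d(x, Z)\<close> on the right of the bound cancels one of the two on the left.\<close>

lemma linearly_regular_average:
  fixes I :: "'n set"
  assumes "finite I" "I \<noteq> {}" and Z: "Z = (\<Inter>i\<in>I. C i)"
    and J: "\<And>i k. i \<in> I \<Longrightarrow> J i k \<in> A"
    and reg: "\<And>i. i \<in> I \<Longrightarrow> linearly_regular_over (\<delta> i) (\<lambda>k. U (J i k) k) (C i) S"
    and \<sigma>: "\<And>i k. i \<in> I \<Longrightarrow> \<sigma> i \<le> \<omega> (J i k) k * \<rho> (J i k) k"
    and \<sigma>_pos: "\<And>i. i \<in> I \<Longrightarrow> \<sigma> i > 0"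
    and family: "linearly_regular_family_over \<kappa> I C S"
  shows "linearly_regular_over (2 * \<kappa>\<^sup>2 * (MAX i\<in>I. \<delta> i)\<^sup>2 / (MIN i\<in>I. \<sigma> i)) V Z S"
proof -
  define d s where "d = (MAX i\<in>I. \<delta> i)" and "s = (MIN i\<in>I. \<sigma> i)"
  have \<delta>_pos: "\<delta> i > 0" if "i \<in> I" for i
    using reg[OF that] by (simp add: linearly_regular_over_def)
  have d_ge: "\<delta> i \<le> d" if "i \<in> I" for i
    using that \<open>finite I\<close> by (simp add: d_def)
  have s_le: "s \<le> \<sigma> i" if "i \<in> I" for i
    using that \<open>finite I\<close> by (simp add: s_def)
  have "s > 0"
    using assms(1,2) \<sigma>_pos by (simp add: s_def)
  have "d > 0"
    using \<open>I \<noteq> {}\<close> \<delta>_pos d_ge by (meson all_not_in_conv less_le_trans)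
  have "\<kappa> > 0"
    using family by (simp add: linearly_regular_family_over_def)
  have "infdist x Z \<le> 2 * \<kappa>\<^sup>2 * d\<^sup>2 / s * norm (V k x - x)" if x: "x \<in> S" for x k
  proof (cases "infdist x Z = 0")
    case True
    then show ?thesis
      using \<open>s > 0\<close> by simp
  next
    case False
    then have pos: "infdist x Z > 0"
      using infdist_nonneg[of x Z] by linarith
    have "(MAX i\<in>I. infdist x (C i)) \<in> (\<lambda>i. infdist x (C i)) ` I"
      using assms(1,2) by (intro Max_in) auto
    then obtain i where i: "i \<in> I" and far: "(MAX i\<in>I. infdist x (C i)) = infdist x (C i)"
      by auto
    let ?r = "norm (U (J i k) k x - x)"
    have "infdist x Z \<le> \<kappa> * infdist x (C i)"
      using family x unfolding linearly_regular_family_over_def Z far[symmetric] by blast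
    also have "\<dots> \<le> \<kappa> * (\<delta> i * ?r)"
      using reg[OF i] x \<open>\<kappa> > 0\<close> by (simp add: linearly_regular_over_def)
    also have "\<dots> \<le> \<kappa> * (d * ?r)"
      using d_ge[OF i] \<open>\<kappa> > 0\<close> by (intro mult_left_mono mult_right_mono) auto
    finally have "(infdist x Z)\<^sup>2 \<le> (\<kappa> * (d * ?r))\<^sup>2"
      using pos by (intro power_mono) auto
    then have "s * (infdist x Z)\<^sup>2 \<le> \<kappa>\<^sup>2 * d\<^sup>2 * (s * ?r\<^sup>2)"
      using \<open>s > 0\<close> by (simp add: power_mult_distrib mult.left_commute mult.assoc)
    also have "\<dots> \<le> \<kappa>\<^sup>2 * d\<^sup>2 * (\<omega> (J i k) k * \<rho> (J i k) k * ?r\<^sup>2)"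
      using s_le[OF i] \<sigma>[OF i, of k] by (intro mult_left_mono mult_right_mono) auto
    also have "\<dots> \<le> \<kappa>\<^sup>2 * d\<^sup>2 * (2 * infdist x Z * norm (V k x - x))"
      using residual_bound_infdist[OF J[OF i]] by (intro mult_left_mono) auto
    finally have "infdist x Z * (s * infdist x Z)
        \<le> infdist x Z * (2 * \<kappa>\<^sup>2 * d\<^sup>2 * norm (V k x - x))"
      by (simp add: power2_eq_square algebra_simps)
    then have "s * infdist x Z \<le> 2 * \<kappa>\<^sup>2 * d\<^sup>2 * norm (V k x - x)"
      using pos by simp
    then show ?thesis
      using \<open>s > 0\<close> by (simp add: field_simps)
  qed
  moreover have "2 * \<kappa>\<^sup>2 * d\<^sup>2 / s > 0"
    using \<open>s > 0\<close> \<open>d > 0\<close> \<open>\<kappa> > 0\<close> by simp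
  ultimately show ?thesis
    unfolding linearly_regular_over_def d_def s_def using quasi_nonexpansive_average by blast
qed

end

section \<open>Passing to the intersection of the target sets\<close>

lemma weakly_regular_over_INT:
  assumes "I \<noteq> {}" and "\<And>i. i \<in> I \<Longrightarrow> weakly_regular_over V (C i) S"
  shows "weakly_regular_over V (\<Inter>i\<in>I. C i) S"
  using assms unfolding weakly_regular_over_def by blast

lemma regular_over_INT:
  assumes "finite I" "I \<noteq> {}" and reg: "\<And>i. i \<in> I \<Longrightarrow> regular_over V (C i) S"
    and family: "regular_family_over I C S"
  shows "regular_over V (\<Inter>i\<in>I. C i) S"
  unfolding regular_over_def
proof (intro conjI allI impI; (elim conjE)?)
  show "quasi_nonexpansive (V k)" for k
    using \<open>I \<noteq> {}\<close> reg unfolding regular_over_def by blast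
  fix x assume x: "\<forall>k. x k \<in> S" and lim: "(\<lambda>k. norm (V k (x k) - x k)) \<longlonglongrightarrow> 0"
  have "(\<lambda>k. infdist (x k) (C i)) \<longlonglongrightarrow> 0" if "i \<in> I" for i
    using reg[OF that] x lim unfolding regular_over_def by blast
  then have "(\<lambda>k. MAX i\<in>I. infdist (x k) (C i)) \<longlonglongrightarrow> 0"
    using assms(1,2) by (intro Max_tendsto_zero) (auto simp: infdist_nonneg)
  then show "(\<lambda>k. infdist (x k) (\<Inter>i\<in>I. C i)) \<longlonglongrightarrow> 0"
    using family x unfolding regular_family_over_def by blast
qed

section \<open>Regularity of averages of operators\<close>

theorem theorem5p1:
  fixes p m :: nat
    and U :: "nat \<Rightarrow> nat \<Rightarrow> 'a::{real_inner, complete_space} \<Rightarrow> 'a"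
    and \<rho> \<omega> :: "nat \<Rightarrow> nat \<Rightarrow> real"
    and V :: "nat \<Rightarrow> 'a \<Rightarrow> 'a"
    and C :: "nat \<Rightarrow> 'a set"
    and S :: "'a set"
  assumes "p \<ge> 1" and "m \<ge> 1"
    and "\<And>j k. j \<in> {1..p} \<Longrightarrow> \<rho> j k \<ge> 0"
    and "\<And>j k. j \<in> {1..p} \<Longrightarrow> strongly_quasi_nonexpansive (\<rho> j k) (U j k)"
    and "\<And>j k. j \<in> {1..p} \<Longrightarrow> \<omega> j k \<ge> 0"
    and "\<And>k. (\<Sum>j\<in>{1..p}. \<omega> j k) = 1"
    and "\<And>k x. V k x = (\<Sum>j\<in>{1..p}. \<omega> j k *\<^sub>R U j k x)"
    and "\<And>i. i \<in> {1..m} \<Longrightarrow> closed (C i)"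
    and "\<And>i. i \<in> {1..m} \<Longrightarrow> convex (C i)"
    and "S \<noteq> {}" and "bounded S"
    and "(\<Inter>i\<in>{1..m}. C i) \<subseteq> (\<Inter>j\<in>{1..p}. \<Inter>k. Fix (U j k))"
    and "(\<Inter>i\<in>{1..m}. C i) \<noteq> {}"
  shows
    "((\<forall>i\<in>{1..m}.
         (\<exists>J. (\<forall>k. J k \<in> {1..p}) \<and> weakly_regular_over (\<lambda>k. U (J k) k) (C i) S \<and>
              (INF k. \<omega> (J k) k * \<rho> (J k) k) > 0)
         \<longrightarrow> weakly_regular_over V (C i) S) \<and>
      ((\<forall>i\<in>{1..m}.
         \<exists>J. (\<forall>k. J k \<in> {1..p}) \<and> weakly_regular_over (\<lambda>k. U (J k) k) (C i) S \<and>
             (INF k. \<omega> (J k) k * \<rho> (J k) k) > 0)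
         \<longrightarrow> weakly_regular_over V (\<Inter>i\<in>{1..m}. C i) S))
     \<and>
     ((\<forall>i\<in>{1..m}.
         (\<exists>J. (\<forall>k. J k \<in> {1..p}) \<and> regular_over (\<lambda>k. U (J k) k) (C i) S \<and>
              (INF k. \<omega> (J k) k * \<rho> (J k) k) > 0)
         \<longrightarrow> regular_over V (C i) S) \<and>
      ((\<forall>i\<in>{1..m}.
         \<exists>J. (\<forall>k. J k \<in> {1..p}) \<and> regular_over (\<lambda>k. U (J k) k) (C i) S \<and>
             (INF k. \<omega> (J k) k * \<rho> (J k) k) > 0) \<and>
       regular_family_over {1..m} C S
         \<longrightarrow> regular_over V (\<Inter>i\<in>{1..m}. C i) S))
     \<and>
     (\<forall>J \<delta> \<sigma> \<kappa>.
        (\<forall>i\<in>{1..m}.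
           (\<forall>k. J i k \<in> {1..p}) \<and>
           linearly_regular_over (\<delta> i) (\<lambda>k. U (J i k) k) (C i) S \<and>
           \<sigma> i = (INF k. \<omega> (J i k) k * \<rho> (J i k) k) \<and> \<sigma> i > 0) \<and>
        linearly_regular_family_over \<kappa> {1..m} C S
          \<longrightarrow> linearly_regular_over
                (2 * \<kappa>\<^sup>2 * (MAX i\<in>{1..m}. \<delta> i)\<^sup>2 / (MIN i\<in>{1..m}. \<sigma> i))
                V (\<Inter>i\<in>{1..m}. C i) S)"
proof -
  interpret averaged_operators "{1..p}" \<omega> \<rho> U V "\<Inter>i\<in>{1..m}. C i"
  proof
    show "(\<Inter>i\<in>{1..m}. C i) \<subseteq> Fix (U j k)" if "j \<in> {1..p}" for j k
      using assms(12) that by blast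
  qed (use assms in auto)
  have I: "finite {1..m}" "{1..m} \<noteq> {}"
    using \<open>m \<ge> 1\<close> by auto
  have weak: "weakly_regular_over V (C i) S"
    if "\<exists>J. (\<forall>k. J k \<in> {1..p}) \<and> weakly_regular_over (\<lambda>k. U (J k) k) (C i) S \<and>
            (INF k. \<omega> (J k) k * \<rho> (J k) k) > 0" for i
    using that weakly_regular_average[OF _ _ \<open>bounded S\<close>] by blast
  have strong: "regular_over V (C i) S"
    if "\<exists>J. (\<forall>k. J k \<in> {1..p}) \<and> regular_over (\<lambda>k. U (J k) k) (C i) S \<and>
            (INF k. \<omega> (J k) k * \<rho> (J k) k) > 0" for i
    using that regular_average[OF _ _ \<open>bounded S\<close>] by blast
  have linear: "linearly_regular_over
      (2 * \<kappa>\<^sup>2 * (MAX i\<in>{1..m}. \<delta> i)\<^sup>2 / (MIN i\<in>{1..m}. \<sigma> i)) V (\<Inter>i\<in>{1..m}. C i) S"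
    if sel: "\<forall>i\<in>{1..m}. (\<forall>k. J i k \<in> {1..p}) \<and>
           linearly_regular_over (\<delta> i) (\<lambda>k. U (J i k) k) (C i) S \<and>
           \<sigma> i = (INF k. \<omega> (J i k) k * \<rho> (J i k) k) \<and> \<sigma> i > 0"
      and family: "linearly_regular_family_over \<kappa> {1..m} C S" for J \<delta> \<sigma> \<kappa>
  proof (rule linearly_regular_average[OF I refl, where J = J])
    show "\<sigma> i \<le> \<omega> (J i k) k * \<rho> (J i k) k" if "i \<in> {1..m}" for i k
      using sel that selected_weight_ge_INF[of "J i" k] by auto
  qed (use sel family in blast)+
  show ?thesis
  proof (intro conjI ballI allI impI; (elim conjE)?)
    show "weakly_regular_over V (\<Inter>i\<in>{1..m}. C i) S"
      if "\<forall>i\<in>{1..m}. \<exists>J. (\<forall>k. J k \<in> {1..p}) \<and>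
            weakly_regular_over (\<lambda>k. U (J k) k) (C i) S \<and>
            (INF k. \<omega> (J k) k * \<rho> (J k) k) > 0"
      using that by (intro weakly_regular_over_INT I weak) blast
    show "regular_over V (\<Inter>i\<in>{1..m}. C i) S"
      if "\<forall>i\<in>{1..m}. \<exists>J. (\<forall>k. J k \<in> {1..p}) \<and>
            regular_over (\<lambda>k. U (J k) k) (C i) S \<and>
            (INF k. \<omega> (J k) k * \<rho> (J k) k) > 0"
        and "regular_family_over {1..m} C S"
      using that by (intro regular_over_INT I strong) blast+
  qed (erule weak | erule strong | rule linear, assumption, assumption)+
qed

end
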